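(* Consider the problem of minimizing $F=f+\psi$ with $f$ convex, where $f$ satisfies the blockwise Lipschitz condition with constants $L_1,\dots,L_N>0$, and consider the inexact randomized block-coordinate descent algorithm with unit step size (Algorithm B) described in the context, with $\eta\in[0,1)$ and started at $x^0$ with $F(x^0)<\infty$. Assume $R_0:=\sup_{x:\,F(x)\le F(x^0)}\|x-P_\Omega(x)\|$ is finite. Let $L_{\max}:=\max_iL_i$, $L_{\min}:=\min_iL_i$, $L_{\mathrm{avg}}:=\frac1N\sum_{i=1}^NL_i$, and $\mathcal L:=\mathrm{diag}(L_1I_{n_1},\dots,L_NI_{n_N})$. Then: 1. With uniform sampling $p^k_i\equiv1/N$: (a) if $F(x^k)-F^*\ge(x^k-P_\Omega(x^k))^\top\mathcal L\,(x^k-P_\Omega(x^k))$, then $$\mathbb E_{i_k}[F(x^{k+1})-F^*\mid x^k]\le\Big(1-\frac{1-\eta}{2N}\Big)(F(x^k)-F^* );$$ (b) for all $k\ge k_0$, where $k_0$ is the smallest $k$ with $F(x^k)-F^*<L_{\max}R_0^2$, $$\mathbb E_{i_{k_0},\dots,i_{k-1}}[F(x^k)\mid x^{k_0}]-F^*\le\frac{2NL_{\max}R_0^2}{2N+(1-\eta)(k-k_0)}.$$ 2. With $p^k_i=\dfrac{L_i}{NL_{\mathrm{avg}}}$, $i=1,\dots,N$: (a) if $F(x^k)-F^*\ge L_{\min}\|x^k-P_\Omega(x^k)\|^2$, then $$\mathbb E_{i_k}[F(x^{k+1})-F^*\mid x^k]\le\Big(1-\frac{L_{\min}(1-\eta)}{2NL_{\mathrm{avg}}}\Big)(F(x^k)-F^*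 );$$ (b) for all $k\ge k_0$, where $k_0$ is the smallest $k$ with $F(x^k)-F^*<L_{\min}R_0^2$, $$\mathbb E_{i_{k_0},\dots,i_{k-1}}[F(x^k)\mid x^{k_0}]-F^*\le\frac{2NL_{\mathrm{avg}}R_0^2}{2N+(1-\eta)(k-k_0)}.$$
   Context: Problem. Minimize $F(x)=f(x)+\psi(x)$ over $x\in\mathbb R^n$, where $x=(x_1,\dots,x_N)$ is split into $N$ blocks $x_i\in\mathbb R^{n_i}$, $\sum_i n_i=n$. $U_i\in\mathbb R^{n\times n_i}$ is the column submatrix of the identity with $x_i=U_i^\top x$; $\nabla_if:=U_i^\top\nabla f$. $f:\mathbb R^n\to\mathbb R$ is continuously differentiable and blockwise Lipschitz: $\|\nabla_if(x+U_ih)-\nabla_if(x)\|\le L_i\|h\|$ for all $x\in\mathbb R^n$, $h\in\mathbb R^{n_i}$, with $L_i>0$. $\psi(x)=\sum_i\psi_i(x_i)$ with each $\psi_i$ convex, extended-valued, proper and closed. $F$ is bounded below and its set of minimizers $\Omega$ is nonempty; $F^*$ is the minimum value; $P_\Omega$ is the Euclidean projection onto $\Omega$. $\|\cdot\|$ is the Euclidean norm. Algorithm B. Given $\eta\in[0,1)$ and $x^0$. At iteration $k=0,1,2,\dots$: with a probability distribution $p^k_1,\dots,p^k_N>0$, $\sum_ip^k_i=1$, sample $i=i_k$ from it. Let $$Q^k_i(d_i):=\nabla_if(x^k)^\top d_i+\tfrac12L_i\|d_i\|^2+\psi_i(x^k_i+d_i)-\psi_i(x^k_i),\qquad Q^{k*}_i:=\inf_{d_i}Q^k_i(d_i),$$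 compute $d^k_i$ satisfying $\eta(Q^k_i(0)-Q^{k*}_i)\ge Q^k_i(d^k_i)-Q^{k*}_i$, and set $x^{k+1}=x^k+U_id^k_i$. Conventions. $\mathbb E_{i_k}[\cdot\mid x^k]$ is the expectation over $i_k$ (distributed according to $\{p^k_i\}$) with everything up to iteration $k$ fixed, where $d^k_i$ denotes the step that would be computed if $i$ were chosen; $\mathbb E_{i_a,\dots,i_b}$ is the expectation over the indicated block choices. *)

theory Defs
  imports "HOL-Analysis.Analysis" "HOL-Probability.Product_PMF"
begin

section \<open>Block decomposition\<close>

text \<open>
  The blocks are indexed by the finite type \<open>'b\<close> (so \<open>N = CARD('b)\<close>), and the map
  \<open>blk :: 'n \<Rightarrow> 'b\<close> assigns to every coordinate of \<open>real ^ 'n\<close> the block it belongs to.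
  Since the block dimensions vary, the space of the \<open>i\<close>-th block is identified isometrically with
  the coordinate subspace \<open>block_space blk i\<close> of \<open>real ^ 'n\<close>.  Under this identification
  \<open>U\<^sub>i\<close> is the inclusion, and its transpose is the coordinate projection \<open>block blk i\<close>.
\<close>

definition block_space :: "('n \<Rightarrow> 'b) \<Rightarrow> 'b \<Rightarrow> (real ^ 'n) set" where
  "block_space blk i = {v. \<forall>j. blk j \<noteq> i \<longrightarrow> v $ j = 0}"

definition block :: "('n \<Rightarrow> 'b) \<Rightarrow> 'b \<Rightarrow> real ^ 'n \<Rightarrow> real ^ 'n" where
  "block blk i v = (\<chi> j. if blk j = i then v $ j else 0)"

definition block_diag :: "('n \<Rightarrow> 'b) \<Rightarrow> ('b \<Rightarrow> real) \<Rightarrow> real ^ 'n ^ 'n" where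
  "block_diag blk L = (\<chi> r c. if r = c then L (blk r) else 0)"


section \<open>Extended-valued convex functions\<close>

text \<open>The library's \<open>epigraph\<close> and \<open>convex_on\<close> only cover real-valued functions.\<close>

definition ext_epigraph :: "'a set \<Rightarrow> ('a \<Rightarrow> ereal) \<Rightarrow> ('a \<times> real) set" where
  "ext_epigraph S h = {(x, t). x \<in> S \<and> h x \<le> ereal t}"

definition ext_convex_on :: "'a::real_vector set \<Rightarrow> ('a \<Rightarrow> ereal) \<Rightarrow> bool" where
  "ext_convex_on S h \<longleftrightarrow> convex (ext_epigraph S h)"

definition ext_proper_on :: "'a set \<Rightarrow> ('a \<Rightarrow> ereal) \<Rightarrow> bool" where
  "ext_proper_on S h \<longleftrightarrow> (\<forall>x\<in>S. h x \<noteq> -\<infinity>) \<and> (\<exists>x\<in>S. h x \<noteq> \<infinity>)"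

definition ext_closed_on :: "'a::topological_space set \<Rightarrow> ('a \<Rightarrow> ereal) \<Rightarrow> bool" where
  "ext_closed_on S h \<longleftrightarrow> closed (ext_epigraph S h)"


section \<open>The algorithm\<close>

definition composite ::
  "('n::finite \<Rightarrow> 'b::finite) \<Rightarrow> (real ^ 'n \<Rightarrow> real) \<Rightarrow> ('b \<Rightarrow> real ^ 'n \<Rightarrow> ereal) \<Rightarrow> real ^ 'n \<Rightarrow> ereal"
  where "composite blk f \<psi> x = ereal (f x) + (\<Sum>i\<in>UNIV. \<psi> i (block blk i x))"

definition subproblem ::
  "('n::finite \<Rightarrow> 'b) \<Rightarrow> (real ^ 'n \<Rightarrow> real ^ 'n) \<Rightarrow> ('b \<Rightarrow> real) \<Rightarrow> ('b \<Rightarrow> real ^ 'n \<Rightarrow> ereal)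
    \<Rightarrow> real ^ 'n \<Rightarrow> 'b \<Rightarrow> real ^ 'n \<Rightarrow> ereal"
  where "subproblem blk grad L \<psi> x i d =
    ereal (block blk i (grad x) \<bullet> d + L i / 2 * (norm d)\<^sup>2)
      + \<psi> i (block blk i x + d) - \<psi> i (block blk i x)"

definition subproblem_inf ::
  "('n::finite \<Rightarrow> 'b) \<Rightarrow> (real ^ 'n \<Rightarrow> real ^ 'n) \<Rightarrow> ('b \<Rightarrow> real) \<Rightarrow> ('b \<Rightarrow> real ^ 'n \<Rightarrow> ereal)
    \<Rightarrow> real ^ 'n \<Rightarrow> 'b \<Rightarrow> ereal"
  where "subproblem_inf blk grad L \<psi> x i =
    (INF d\<in>block_space blk i. subproblem blk grad L \<psi> x i d)"

text \<open>
  The random block choices are a sequence \<open>\<omega> :: nat \<Rightarrow> 'b\<close>, where \<open>\<omega> k\<close> is the block used at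
  iteration \<open>k\<close>.  The iterate \<open>x k \<omega>\<close> and the steps \<open>d k \<omega> i\<close> (the step that would be computed at
  iteration \<open>k\<close> if block \<open>i\<close> were chosen) depend only on \<open>\<omega> 0, \<dots>, \<omega> (k - 1)\<close>; for \<open>x\<close> this
  follows from the recursion.  The sampling distributions enter only through the expectations
  below.
\<close>

definition inexact_rcd ::
  "real \<Rightarrow> ('n::finite \<Rightarrow> 'b) \<Rightarrow> (real ^ 'n \<Rightarrow> real ^ 'n) \<Rightarrow> ('b \<Rightarrow> real) \<Rightarrow> ('b \<Rightarrow> real ^ 'n \<Rightarrow> ereal)
    \<Rightarrow> real ^ 'n \<Rightarrow> (nat \<Rightarrow> (nat \<Rightarrow> 'b) \<Rightarrow> real ^ 'n) \<Rightarrow> (nat \<Rightarrow> (nat \<Rightarrow> 'b) \<Rightarrow> 'b \<Rightarrow> real ^ 'n) \<Rightarrow> bool"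
  where "inexact_rcd \<eta> blk grad L \<psi> x0 x d \<longleftrightarrow>
    (\<forall>\<omega>. x 0 \<omega> = x0) \<and>
    (\<forall>k \<omega>. x (Suc k) \<omega> = x k \<omega> + d k \<omega> (\<omega> k)) \<and>
    (\<forall>k \<omega> \<omega>'. (\<forall>j<k. \<omega> j = \<omega>' j) \<longrightarrow> d k \<omega> = d k \<omega>') \<and>
    (\<forall>k \<omega> i. d k \<omega> i \<in> block_space blk i \<and>
      ereal \<eta> * (subproblem blk grad L \<psi> (x k \<omega>) i 0 - subproblem_inf blk grad L \<psi> (x k \<omega>) i)
        \<ge> subproblem blk grad L \<psi> (x k \<omega>) i (d k \<omega> i) - subproblem_inf blk grad L \<psi> (x k \<omega>) i)"


section \<open>Expectation over block choices\<close>

text \<open>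
  The library's Bochner integral does not cover functions with values in \<^typ>\<open>ereal\<close>; all
  distributions used here have finite support, so a finite weighted sum suffices.
\<close>

definition ereal_expectation :: "'c pmf \<Rightarrow> ('c \<Rightarrow> ereal) \<Rightarrow> ereal" where
  "ereal_expectation q X = (\<Sum>c\<in>set_pmf q. ereal (pmf q c) * X c)"

lemma ereal_expectation_real:
  assumes "finite (set_pmf q)"
  shows "ereal_expectation q (\<lambda>c. ereal (X c)) = ereal (measure_pmf.expectation q X)"
proof -
  have "measure_pmf.expectation q X = (\<Sum>c\<in>set_pmf q. X c * pmf q c)"
    using assms by (intro integral_measure_pmf_real) auto
  then show ?thesis
    by (simp add: ereal_expectation_def mult.commute)
qed

text \<open>
  The expectation over the choices at iterations \<open>a, \<dots>, b - 1\<close>, drawn independently with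
  \<open>\<omega> k\<close> distributed according to \<open>p k\<close>, while the other entries of \<open>\<omega>\<close> stay fixed.
\<close>

definition block_expectation ::
  "(nat \<Rightarrow> 'b pmf) \<Rightarrow> nat \<Rightarrow> nat \<Rightarrow> ((nat \<Rightarrow> 'b) \<Rightarrow> ereal) \<Rightarrow> (nat \<Rightarrow> 'b) \<Rightarrow> ereal" where
  "block_expectation p a b X \<omega> =
    ereal_expectation (Pi_pmf {a..<b} undefined p) (\<lambda>\<iota>. X (override_on \<omega> \<iota> {a..<b}))"

end

theory Submission
  imports Defs
begin

text \<open>
  Each step realizes at least the fraction \<open>1 - \<eta>\<close> of the best decrease of a model that majorizes the
  change of the objective when a single block is moved.  The expected decrease is therefore at least
  \<open>(1 - \<eta>) * (\<Sum>i. pmf p i * - Qmin i)\<close>, where \<open>Qmin i \<le> 0\<close> is the optimal model value of block \<open>i\<close>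
  (lemmas \<open>block_descent\<close>, \<open>F_block_step\<close>, \<open>inexact_step_gap\<close>).

  Both sampling rules are of the form \<open>pmf p i = w i / W\<close> with weights \<open>w i\<close> and total \<open>W\<close>: the weights
  are \<open>1\<close> for uniform sampling and \<open>L i\<close> for the other rule.  With \<open>z\<close> the projection of the iterate \<open>y\<close>
  onto the minimizers, inserting block \<open>i\<close> of \<open>(\<theta> / w i) * (z - y)\<close> into the \<open>i\<close>-th model and
  using convexity gives (lemma \<open>weighted_sum_Qmin_le\<close>)

  \<open>(\<Sum>i. w i * Qmin i) \<le> - \<theta> * gap + \<theta>\<^sup>2 / 2 * D\<close> for \<open>0 \<le> \<theta> \<le> min w\<close>,

  where \<open>D\<close> is the sum of \<open>L i / w i\<close> times the squared norms of the blocks of \<open>y - z\<close>.  So \<open>D\<close> is the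
  squared distance weighted by \<open>block_diag blk L\<close> in the uniform case and the plain squared distance
  in the other.  Everything else is one-dimensional.  If the gap is at least \<open>min w * D\<close>, the choice
  \<open>\<theta> = min w\<close> gives a decrease by a constant factor (\<open>expected_linear_decrease\<close>).  Once the gap is below
  \<open>min w * C\<close> with \<open>C\<close> an upper bound of \<open>D\<close> on the initial level set, the choice \<open>\<theta> = gap / C\<close> gives
  an expected decrease proportional to the squared gap; by Jensen's inequality the expected gaps
  satisfy \<open>e (Suc n) \<le> e n - c * (e n)\<^sup>2\<close>, and hence decay like \<open>1 / n\<close> (\<open>quadratic_decrease_rate\<close>,
  \<open>expectation_quadratic_decrease\<close>, \<open>expected_sublinear_rate\<close>).
\<close>

section \<open>Coordinate blocks\<close>

lemma block_in_block_space: "block blk i v \<in> block_space blk i"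
  by (simp add: block_def block_space_def)

lemma block_add: "block blk i (u + v) = block blk i u + block blk i v"
  by (simp add: block_def vec_eq_iff)

lemma block_diff: "block blk i (u - v) = block blk i u - block blk i v"
  by (simp add: block_def vec_eq_iff)

lemma block_scaleR: "block blk i (c *\<^sub>R v) = c *\<^sub>R block blk i v"
  by (simp add: block_def vec_eq_iff)

lemma block_space_scaleR: "h \<in> block_space blk i \<Longrightarrow> c *\<^sub>R h \<in> block_space blk i"
  by (simp add: block_space_def)

lemma block_same: "h \<in> block_space blk i \<Longrightarrow> block blk i h = h"
  by (simp add: block_def block_space_def vec_eq_iff)

lemma block_other: "h \<in> block_space blk i \<Longrightarrow> j \<noteq> i \<Longrightarrow> block blk j h = 0"
  by (auto simp: block_def block_space_def vec_eq_iff)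

lemma inner_block_space:
  fixes blk :: "'n::finite \<Rightarrow> 'b"
  shows "h \<in> block_space blk i \<Longrightarrow> g \<bullet> h = block blk i g \<bullet> h"
  by (auto simp: block_def block_space_def inner_vec_def intro!: sum.cong)

lemma inner_block_diag:
  fixes blk :: "'n::finite \<Rightarrow> 'b::finite"
  shows "v \<bullet> (block_diag blk L *v v) = (\<Sum>i\<in>UNIV. L i * (norm (block blk i v))\<^sup>2)"
proof -
  have "v \<bullet> (block_diag blk L *v v) = (\<Sum>j\<in>UNIV. L (blk j) * (v $ j)\<^sup>2)"
    by (simp add: inner_vec_def matrix_vector_mult_def block_diag_def if_distrib[of "\<lambda>c. c * _"]
        power2_eq_square mult.left_commute cong: if_cong)
  also have "\<dots> = (\<Sum>j\<in>UNIV. \<Sum>i\<in>UNIV. if blk j = i then L i * (v $ j)\<^sup>2 else 0)"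
    by simp
  also have "\<dots> = (\<Sum>i\<in>UNIV. \<Sum>j\<in>UNIV. if blk j = i then L i * (v $ j)\<^sup>2 else 0)"
    by (rule sum.swap)
  also have "\<dots> = (\<Sum>i\<in>UNIV. L i * (norm (block blk i v))\<^sup>2)"
    unfolding power2_norm_eq_inner
    by (auto simp: inner_vec_def block_def sum_distrib_left power2_eq_square intro!: sum.cong)
  finally show ?thesis .
qed

lemma inner_sum_blocks:
  fixes blk :: "'n::finite \<Rightarrow> 'b::finite"
  shows "(\<Sum>i\<in>UNIV. block blk i u \<bullet> block blk i v) = u \<bullet> v"
proof -
  have "(\<Sum>i\<in>UNIV. block blk i u \<bullet> block blk i v)
      = (\<Sum>i\<in>UNIV. \<Sum>j\<in>UNIV. if blk j = i then u $ j * v $ j else 0)"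
    by (auto simp: inner_vec_def block_def intro!: sum.cong)
  also have "\<dots> = (\<Sum>j\<in>UNIV. \<Sum>i\<in>UNIV. if blk j = i then u $ j * v $ j else 0)"
    by (rule sum.swap)
  also have "\<dots> = u \<bullet> v"
    by (simp add: inner_vec_def)
  finally show ?thesis .
qed

lemma norm_sum_blocks:
  fixes blk :: "'n::finite \<Rightarrow> 'b::finite"
  shows "(\<Sum>i\<in>UNIV. (norm (block blk i v))\<^sup>2) = (norm v)\<^sup>2"
  by (simp add: power2_norm_eq_inner inner_sum_blocks)

lemma continuous_block: "continuous_on S (block blk i :: real^'n::finite \<Rightarrow> real^'n)"
proof -
  have "linear (block blk i :: real^'n \<Rightarrow> real^'n)"
    by (rule linearI) (simp_all add: block_add block_scaleR)
  then show ?thesis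
    by (simp add: linear_continuous_on linear_conv_bounded_linear)
qed

section \<open>Gradients along lines\<close>

lemma GDERIV_line:
  fixes f :: "'a::real_inner \<Rightarrow> real"
  assumes "GDERIV f (y + t *\<^sub>R h) :> g"
  shows "((\<lambda>t. f (y + t *\<^sub>R h)) has_real_derivative g \<bullet> h) (at t)"
proof -
  have "((\<lambda>t. y + t *\<^sub>R h) has_derivative (\<lambda>s. s *\<^sub>R h)) (at t)"
    by (auto intro!: derivative_eq_intros)
  moreover have "(f has_derivative (\<bullet>) g) (at (y + t *\<^sub>R h))"
    using assms by (simp add: gderiv_def inner_commute[of _ g])
  ultimately have "((\<lambda>t. f (y + t *\<^sub>R h)) has_derivative (\<lambda>s. g \<bullet> (s *\<^sub>R h))) (at t)"
    by (rule has_derivative_compose)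
  then show ?thesis
    by (simp add: has_field_derivative_def mult_commute_abs)
qed

lemma convex_gradient_inequality:
  fixes f :: "'a::real_inner \<Rightarrow> real"
  assumes "convex_on UNIV f" and "GDERIV f y :> g"
  shows "f y + g \<bullet> (z - y) \<le> f z"
proof -
  let ?\<phi> = "\<lambda>t. f (y + t *\<^sub>R (z - y))"
  have "((\<lambda>t. (?\<phi> t - ?\<phi> 0) / t) \<longlongrightarrow> g \<bullet> (z - y)) (at_right 0)"
    using GDERIV_line[of f y 0 "z - y" g] assms(2)
    by (auto simp: has_field_derivative_iff intro: filterlim_mono[OF _ order_refl at_le])
  moreover have "(?\<phi> t - ?\<phi> 0) / t \<le> f z - f y" if "0 < t" "t < 1" for t
  proof -
    have "f ((1 - t) *\<^sub>R y + t *\<^sub>R z) \<le> (1 - t) * f y + t * f z"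
      using assms(1) that by (intro convex_onD) auto
    moreover have "(1 - t) *\<^sub>R y + t *\<^sub>R z = y + t *\<^sub>R (z - y)"
      by (simp add: algebra_simps)
    ultimately show ?thesis
      using that by (simp add: field_simps)
  qed
  then have "eventually (\<lambda>t. (?\<phi> t - ?\<phi> 0) / t \<le> f z - f y) (at_right 0)"
    by (auto simp: eventually_at_right_field intro!: exI[of _ 1])
  ultimately have "g \<bullet> (z - y) \<le> f z - f y"
    by (rule tendsto_upperbound) simp
  then show ?thesis
    by simp
qed

section \<open>Convexity and lower semicontinuity of extended-valued functions\<close>

lemma ext_convex_onD:
  assumes "ext_convex_on S h" "u \<in> S" "v \<in> S" "h u \<le> ereal a" "h v \<le> ereal b" "0 \<le> t" "t \<le> 1"
  shows "h ((1 - t) *\<^sub>R u + t *\<^sub>R v) \<le> ereal ((1 - t) * a + t * b)"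
  using convexD_alt[of "ext_epigraph S h" "(u, a)" "(v, b)" t] assms
  by (simp add: ext_convex_on_def ext_epigraph_def)

lemma ereal_less_sumE:
  fixes u v :: ereal
  assumes "ereal r < u + v" "u \<noteq> -\<infinity>" "v \<noteq> -\<infinity>"
  obtains a b where "ereal a < u" "ereal b < v" "r \<le> a + b"
proof (cases u; cases v)
  fix s t assume st: "u = ereal s" "v = ereal t"
  then have "r < s + t" using assms by simp
  then show thesis using st
    by (intro that[of "s - (s + t - r) / 2" "t - (s + t - r) / 2"]) (auto simp: field_simps)
next
  fix s assume "u = ereal s" "v = \<infinity>"
  then show thesis by (intro that[of "s - 1" "r - s + 1"]) auto
next
  fix t assume "v = ereal t" "u = \<infinity>"
  then show thesis by (intro that[of "r - t + 1" "t - 1"]) auto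
next
  assume "u = \<infinity>" "v = \<infinity>"
  then show thesis by (intro that[of r 0]) auto
qed (use assms in auto)

text \<open>
  Openness of all superlevel sets is lower semicontinuity.  It passes to sums because a strict lower
  bound on a sum splits into strict real lower bounds on the summands; values \<open>-\<infinity>\<close> have to be
  excluded, as \<open>\<infinity> + -\<infinity>\<close> is \<open>\<infinity>\<close> for extended reals.
\<close>

lemma open_superlevel_add:
  fixes g h :: "'a::topological_space \<Rightarrow> ereal"
  assumes "\<And>r. open {y. ereal r < g y}" "\<And>r. open {y. ereal r < h y}"
    and "\<And>y. g y \<noteq> -\<infinity>" "\<And>y. h y \<noteq> -\<infinity>"
  shows "open {y. ereal r < g y + h y}"
proof -
  have "{y. ereal r < g y + h y}
      = (\<Union>(a, b)\<in>{(a, b). r \<le> a + b}. {y. ereal a < g y} \<inter> {y. ereal b < h y})"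
  proof (intro set_eqI iffI)
    fix y assume "y \<in> {y. ereal r < g y + h y}"
    then show "y \<in> (\<Union>(a, b)\<in>{(a, b). r \<le> a + b}. {y. ereal a < g y} \<inter> {y. ereal b < h y})"
      using ereal_less_sumE[of r "g y" "h y"] assms(3,4) by (simp, metis)
  next
    fix y assume "y \<in> (\<Union>(a, b)\<in>{(a, b). r \<le> a + b}. {y. ereal a < g y} \<inter> {y. ereal b < h y})"
    then obtain a b where ab: "r \<le> a + b" "ereal a < g y" "ereal b < h y"
      by auto
    have "ereal r \<le> ereal a + ereal b" using ab by simp
    also have "\<dots> < g y + h y" using ab
      by (cases "g y"; cases "h y") auto
    finally show "y \<in> {y. ereal r < g y + h y}" by simp
  qed
  then show ?thesis
    using assms(1,2) by (auto intro!: open_UN)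
qed

lemma sum_ereal_neq_MInfty:
  fixes g :: "'c \<Rightarrow> ereal"
  shows "(\<And>i. i \<in> I \<Longrightarrow> g i \<noteq> -\<infinity>) \<Longrightarrow> (\<Sum>i\<in>I. g i) \<noteq> -\<infinity>"
  by (induction I rule: infinite_finite_induct) auto

lemma open_superlevel_sum:
  fixes g :: "'c \<Rightarrow> 'a::topological_space \<Rightarrow> ereal"
  assumes "finite I" "\<And>i r. i \<in> I \<Longrightarrow> open {y. ereal r < g i y}"
    and "\<And>i y. i \<in> I \<Longrightarrow> g i y \<noteq> -\<infinity>"
  shows "open {y. ereal r < (\<Sum>i\<in>I. g i y)}"
  using assms
proof (induction I arbitrary: r)
  case (insert j I)
  have "(\<Sum>i\<in>I. g i y) \<noteq> -\<infinity>" for y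
    using insert.prems by (intro sum_ereal_neq_MInfty) auto
  moreover have "open {y. ereal r < (\<Sum>i\<in>I. g i y)}" for r
    using insert.prems by (intro insert.IH) auto
  ultimately show ?case
    using insert.hyps insert.prems by (simp add: open_superlevel_add)
qed (simp add: zero_ereal_def)

section \<open>Composite minimization with separable regularizer\<close>

locale composite_minimization =
  fixes blk :: "'n::finite \<Rightarrow> 'b::finite"
    and f :: "real ^ 'n \<Rightarrow> real" and grad :: "real ^ 'n \<Rightarrow> real ^ 'n"
    and \<psi> :: "'b \<Rightarrow> real ^ 'n \<Rightarrow> ereal"
    and L :: "'b \<Rightarrow> real"
  assumes f_grad: "\<And>y. GDERIV f y :> grad y"
    and f_convex: "convex_on UNIV f"
    and f_lipschitz: "\<And>i y h. h \<in> block_space blk i \<Longrightarrow>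
      norm (block blk i (grad (y + h)) - block blk i (grad y)) \<le> L i * norm h"
    and psi_convex: "\<And>i. ext_convex_on (block_space blk i) (\<psi> i)"
    and psi_proper: "\<And>i. ext_proper_on (block_space blk i) (\<psi> i)"
    and psi_closed: "\<And>i. ext_closed_on (block_space blk i) (\<psi> i)"
    and minimizer_exists: "{y. \<forall>z. composite blk f \<psi> y \<le> composite blk f \<psi> z} \<noteq> {}"
    and domain_nonempty: "\<exists>y. composite blk f \<psi> y < \<infinity>"
begin

abbreviation F :: "real ^ 'n \<Rightarrow> ereal"
  where "F \<equiv> composite blk f \<psi>"

definition minimizers :: "(real ^ 'n) set"
  where "minimizers = {y. \<forall>z. F y \<le> F z}"

definition Fmin :: real
  where "Fmin = real_of_ereal (INF y. F y)"

text \<open>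
  On the domain of \<open>F\<close>, which contains every iterate, nothing is lost in the passage to real numbers;
  outside it the value is arbitrary.  The same holds for \<open>psi_at\<close> and \<open>Qmin\<close>.
\<close>

definition gap :: "real ^ 'n \<Rightarrow> real"
  where "gap y = real_of_ereal (F y) - Fmin"

definition psi_at :: "'b \<Rightarrow> real ^ 'n \<Rightarrow> real"
  where "psi_at i y = real_of_ereal (\<psi> i (block blk i y))"

lemma psi_neq_MInfty: "v \<in> block_space blk i \<Longrightarrow> \<psi> i v \<noteq> -\<infinity>"
  using psi_proper[of i] by (auto simp: ext_proper_on_def)

lemma psi_block_neq_MInfty: "\<psi> i (block blk i y) \<noteq> -\<infinity>"
  by (rule psi_neq_MInfty[OF block_in_block_space])

lemma F_neq_MInfty: "F y \<noteq> -\<infinity>"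
  by (simp add: composite_def sum_ereal_neq_MInfty psi_block_neq_MInfty)

lemma psi_eq_real:
  assumes "F y < \<infinity>"
  shows "\<psi> i (block blk i y) = ereal (psi_at i y)"
proof -
  have "\<psi> i (block blk i y) \<noteq> \<infinity>"
    using assms by (auto simp: composite_def sum_Pinfty)
  then show ?thesis
    using psi_block_neq_MInfty[of i y] unfolding psi_at_def
    by (cases "\<psi> i (block blk i y)") auto
qed

lemma F_eq_real: "F y < \<infinity> \<Longrightarrow> F y = ereal (f y + (\<Sum>i\<in>UNIV. psi_at i y))"
  by (simp add: composite_def psi_eq_real)

lemma INF_F_eq: "(INF y. F y) = ereal Fmin"
  and F_minimizer: "z \<in> minimizers \<Longrightarrow> F z = ereal Fmin"
proof -
  have inf: "(INF y. F y) = F z" if "z \<in> minimizers" for z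
    using that by (intro antisym INF_lower INF_greatest) (auto simp: minimizers_def)
  obtain z where z: "z \<in> minimizers"
    using minimizer_exists by (auto simp: minimizers_def)
  obtain y where "F y < \<infinity>"
    using domain_nonempty by blast
  then have "F z < \<infinity>"
    using z le_less_trans by (auto simp: minimizers_def)
  then have "\<bar>F z\<bar> \<noteq> \<infinity>"
    using F_neq_MInfty[of z] by auto
  then show eq: "(INF y. F y) = ereal Fmin"
    by (simp add: Fmin_def inf[OF z] ereal_real')
  show "F z = ereal Fmin" if "z \<in> minimizers" for z
    using inf[OF that] eq by simp
qed

lemma F_eq_gap:
  assumes "F y < \<infinity>"
  shows "F y = ereal (Fmin + gap y)"
  using assms F_neq_MInfty[of y] by (cases "F y") (auto simp: gap_def)

lemma gap_eq: "F y < \<infinity> \<Longrightarrow> gap y = f y + (\<Sum>i\<in>UNIV. psi_at i y) - Fmin"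
  by (simp add: gap_def F_eq_real)

lemma Fmin_le: "ereal Fmin \<le> F y"
  unfolding INF_F_eq[symmetric] by (simp add: INF_lower)

lemma gap_nonneg: "F y < \<infinity> \<Longrightarrow> 0 \<le> gap y"
  using Fmin_le[of y] by (simp add: F_eq_gap)

lemma minimizer_finite: "z \<in> minimizers \<Longrightarrow> F z < \<infinity>"
  by (simp add: F_minimizer)

lemma gap_minimizer: "z \<in> minimizers \<Longrightarrow> gap z = 0"
  by (simp add: gap_def F_minimizer)

lemma open_superlevel_psi: "open {y. ereal r < \<psi> i (block blk i y)}"
proof -
  have "closed ((\<lambda>y. (block blk i y, r)) -` ext_epigraph (block_space blk i) (\<psi> i))"
    using psi_closed[of i]
    by (intro closed_vimage continuous_intros continuous_block) (simp add: ext_closed_on_def)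
  moreover have "{y. ereal r < \<psi> i (block blk i y)}
      = - ((\<lambda>y. (block blk i y, r)) -` ext_epigraph (block_space blk i) (\<psi> i))"
    by (auto simp: ext_epigraph_def block_in_block_space not_le)
  ultimately show ?thesis
    by (simp add: open_Compl)
qed

text \<open>
  The set of minimizers is the complement of a superlevel set of the lower semicontinuous function
  \<open>F\<close>.  Closedness is what makes \<open>closest_point\<close> return a minimizer.
\<close>

lemma closed_minimizers: "closed minimizers"
proof -
  have "isCont f y" for y
    using f_grad[of y] unfolding gderiv_def by (rule has_derivative_continuous)
  then have "continuous_on UNIV f"
    by (intro continuous_at_imp_continuous_on ballI)
  then have f: "open {y. ereal r < ereal (f y)}" for r
    using open_Collect_less[OF continuous_on_const, of f r] by simp
  have psi: "open {y. ereal r < (\<Sum>i\<in>UNIV. \<psi> i (block blk i y))}" for r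
    by (rule open_superlevel_sum[OF finite open_superlevel_psi psi_block_neq_MInfty])
  have "open {y. ereal r < F y}" for r
    unfolding composite_def
    by (rule open_superlevel_add[OF f psi _ sum_ereal_neq_MInfty]) (simp_all add: psi_block_neq_MInfty)
  moreover have "minimizers = - {y. ereal Fmin < F y}"
  proof -
    have "y \<in> minimizers" if "F y \<le> ereal Fmin" for y
      unfolding minimizers_def by (simp add: order_trans[OF that Fmin_le])
    then show ?thesis
      by (auto simp: F_minimizer simp flip: not_le)
  qed
  ultimately show ?thesis
    by (simp add: closed_Compl)
qed

lemma closest_minimizer: "closest_point minimizers y \<in> minimizers"
  using closed_minimizers minimizer_exists
  by (intro closest_point_in_set) (simp_all add: minimizers_def)

text \<open>
  The slope along the segment from \<open>y\<close> to \<open>y + h\<close> grows at most at rate \<open>L i * (norm h)\<^sup>2\<close>, so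
  subtracting the quadratic upper model from \<open>f\<close> leaves a nonincreasing function of the position
  on the segment.
\<close>

lemma block_descent:
  assumes h: "h \<in> block_space blk i"
  shows "f (y + h) \<le> f y + block blk i (grad y) \<bullet> h + L i / 2 * (norm h)\<^sup>2"
proof -
  let ?\<phi> = "\<lambda>t. f (y + t *\<^sub>R h) - t * (block blk i (grad y) \<bullet> h) - L i / 2 * t\<^sup>2 * (norm h)\<^sup>2"
  have "?\<phi> 1 \<le> ?\<phi> 0"
  proof (rule DERIV_nonpos_imp_nonincreasing[where f = "?\<phi>" and a = 0 and b = 1])
    fix t :: real assume "0 \<le> t" "t \<le> 1"
    have "(block blk i (grad (y + t *\<^sub>R h)) - block blk i (grad y)) \<bullet> h
        \<le> (L i * norm (t *\<^sub>R h)) * norm h"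
      by (intro order_trans[OF norm_cauchy_schwarz] mult_right_mono f_lipschitz
          block_space_scaleR h norm_ge_zero)
    then have "grad (y + t *\<^sub>R h) \<bullet> h - block blk i (grad y) \<bullet> h - L i * t * (norm h)\<^sup>2 \<le> 0"
      using \<open>0 \<le> t\<close>
      by (simp add: inner_block_space[OF h, of "grad (y + t *\<^sub>R h)"] inner_diff_left
          power2_eq_square algebra_simps)
    moreover have "DERIV ?\<phi> t :>
        grad (y + t *\<^sub>R h) \<bullet> h - block blk i (grad y) \<bullet> h - L i * t * (norm h)\<^sup>2"
      by (auto intro!: derivative_eq_intros GDERIV_line f_grad)
    ultimately show "\<exists>s. DERIV ?\<phi> t :> s \<and> s \<le> 0"
      by blast
  qed simp
  then show ?thesis
    by simp
qed

abbreviation Q :: "real ^ 'n \<Rightarrow> 'b \<Rightarrow> real ^ 'n \<Rightarrow> ereal"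
  where "Q \<equiv> subproblem blk grad L \<psi>"

text \<open>
  The descent inequality for \<open>f\<close>, together with the fact that only the \<open>i\<close>-th summand of the
  regularizer changes: the block model majorizes the true change of the objective.
\<close>

lemma F_block_step:
  assumes "F y < \<infinity>" "h \<in> block_space blk i"
  shows "F (y + h) \<le> F y + Q y i h"
proof (cases "\<psi> i (block blk i y + h) = \<infinity>")
  case True
  then show ?thesis
    using assms by (simp add: subproblem_def psi_eq_real F_eq_gap)
next
  case False
  have "block blk i y + h \<in> block_space blk i"
    using assms(2) by (metis block_add block_in_block_space block_same)
  then obtain c where c: "\<psi> i (block blk i y + h) = ereal c"
    using False psi_neq_MInfty by (metis ereal_cases)
  have "(\<Sum>j\<in>UNIV. \<psi> j (block blk j (y + h)))
      = \<psi> i (block blk i (y + h)) + (\<Sum>j\<in>UNIV - {i}. \<psi> j (block blk j (y + h)))"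
    by (rule sum.remove) auto
  also have "(\<Sum>j\<in>UNIV - {i}. \<psi> j (block blk j (y + h))) = (\<Sum>j\<in>UNIV - {i}. ereal (psi_at j y))"
    using assms by (intro sum.cong) (simp_all add: block_add block_other psi_eq_real)
  finally have "F (y + h) = ereal (f (y + h) + (c + (\<Sum>j\<in>UNIV - {i}. psi_at j y)))"
    using assms(2) c by (simp add: composite_def block_add block_same)
  moreover have "F y = ereal (f y + (psi_at i y + (\<Sum>j\<in>UNIV - {i}. psi_at j y)))"
    using assms(1) by (simp add: F_eq_real sum.remove[of UNIV i])
  ultimately show ?thesis
    using block_descent[OF assms(2), of y] assms(1) by (simp add: subproblem_def c psi_eq_real)
qed

definition Qmin :: "real ^ 'n \<Rightarrow> 'b \<Rightarrow> real"
  where "Qmin y i = real_of_ereal (subproblem_inf blk grad L \<psi> y i)"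

lemma subproblem_zero: "F y < \<infinity> \<Longrightarrow> Q y i 0 = 0"
  by (simp add: subproblem_def psi_eq_real zero_ereal_def)

lemma subproblem_inf_le: "h \<in> block_space blk i \<Longrightarrow> subproblem_inf blk grad L \<psi> y i \<le> Q y i h"
  unfolding subproblem_inf_def by (rule INF_lower)

text \<open>
  The block model is bounded below because it majorizes a change of \<open>F\<close>, and \<open>F\<close> can drop by at most
  the gap.  The inexactness criterion measures the computed step
  against this infimum, so it yields a decrease only because the infimum is finite.
\<close>

lemma subproblem_inf_eq_real:
  assumes "F y < \<infinity>"
  shows "subproblem_inf blk grad L \<psi> y i = ereal (Qmin y i)"
proof -
  have "ereal (- gap y) \<le> subproblem_inf blk grad L \<psi> y i"
    unfolding subproblem_inf_def
  proof (rule INF_greatest)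
    fix h assume "h \<in> block_space blk i"
    then have "ereal Fmin \<le> ereal (Fmin + gap y) + Q y i h"
      using order_trans[OF Fmin_le F_block_step[OF assms]] assms by (simp add: F_eq_gap)
    then show "ereal (- gap y) \<le> Q y i h"
      by (cases "Q y i h") auto
  qed
  moreover have "subproblem_inf blk grad L \<psi> y i \<le> 0"
    using subproblem_inf_le[of 0 i y] subproblem_zero[OF assms] by (simp add: block_space_def)
  ultimately show ?thesis
    unfolding Qmin_def by (cases "subproblem_inf blk grad L \<psi> y i") auto
qed

lemma Qmin_nonpos: "F y < \<infinity> \<Longrightarrow> Qmin y i \<le> 0"
  using subproblem_inf_le[of 0 i y] subproblem_zero[of y i] subproblem_inf_eq_real[of y i]
  by (simp add: block_space_def zero_ereal_def)

text \<open>
  A trial step that moves block \<open>i\<close> the fraction \<open>t\<close> of the way towards \<open>z\<close> bounds the optimal model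
  value; convexity controls the change of \<open>\<psi> i\<close>.
\<close>

lemma Qmin_le:
  assumes "F y < \<infinity>" "F z < \<infinity>" "0 \<le> t" "t \<le> 1"
  shows "Qmin y i \<le> t * (block blk i (grad y) \<bullet> block blk i (z - y) + (psi_at i z - psi_at i y))
    + t\<^sup>2 * (L i / 2 * (norm (block blk i (z - y)))\<^sup>2)"
proof -
  let ?v = "block blk i (z - y)"
  have "\<psi> i ((1 - t) *\<^sub>R block blk i y + t *\<^sub>R block blk i z)
      \<le> ereal ((1 - t) * psi_at i y + t * psi_at i z)"
    using assms
    by (intro ext_convex_onD[OF psi_convex] block_in_block_space) (simp_all add: psi_eq_real)
  then have psi: "\<psi> i (block blk i y + t *\<^sub>R ?v) \<le> ereal ((1 - t) * psi_at i y + t * psi_at i z)"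
    by (simp add: block_diff algebra_simps)
  have "ereal (Qmin y i) \<le> Q y i (t *\<^sub>R ?v)"
    using assms subproblem_inf_le[of "t *\<^sub>R ?v" i y]
    by (simp add: subproblem_inf_eq_real block_space_scaleR block_in_block_space)
  also have "\<dots> \<le> ereal (block blk i (grad y) \<bullet> (t *\<^sub>R ?v) + L i / 2 * (norm (t *\<^sub>R ?v))\<^sup>2)
      + ereal ((1 - t) * psi_at i y + t * psi_at i z) - ereal (psi_at i y)"
    unfolding subproblem_def psi_eq_real[OF assms(1)]
    by (intro ereal_minus_mono add_left_mono psi order_refl)
  finally show ?thesis
    by (simp add: power_mult_distrib algebra_simps)
qed

text \<open>
  The heart of the argument.  In block \<open>i\<close> the trial step covers the fraction \<open>\<theta> / w i\<close> of the way
  towards the minimizer, so that multiplication by the weight \<open>w i\<close> gives every block the same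
  factor \<open>\<theta>\<close> on its linear term.  The linear terms then add up to \<open>\<theta>\<close> times a first-order model of
  \<open>F z - F y\<close>, which convexity of \<open>f\<close> bounds by the negative gap.  The condition \<open>\<theta> \<le> w i\<close> keeps the
  fractions at most one.
\<close>

lemma weighted_sum_Qmin_le:
  assumes y: "F y < \<infinity>" and z: "z \<in> minimizers"
    and w: "\<And>i. 0 < w i" and theta: "0 \<le> \<theta>" "\<And>i. \<theta> \<le> w i"
  shows "(\<Sum>i\<in>UNIV. w i * Qmin y i)
    \<le> - \<theta> * gap y + \<theta>\<^sup>2 / 2 * (\<Sum>i\<in>UNIV. L i / w i * (norm (block blk i (y - z)))\<^sup>2)"
proof -
  let ?lin = "\<lambda>i. block blk i (grad y) \<bullet> block blk i (z - y) + (psi_at i z - psi_at i y)"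
  let ?sq = "\<lambda>i. L i / w i * (norm (block blk i (y - z)))\<^sup>2"
  have "w i * Qmin y i \<le> \<theta> * ?lin i + \<theta>\<^sup>2 / 2 * ?sq i" for i
  proof -
    have "w i * Qmin y i \<le> w i * ((\<theta> / w i) * ?lin i
        + (\<theta> / w i)\<^sup>2 * (L i / 2 * (norm (block blk i (z - y)))\<^sup>2))"
      using w[of i] theta(1) theta(2)[of i] by (intro mult_left_mono Qmin_le y minimizer_finite z) auto
    also have "\<dots> = \<theta> * ?lin i + \<theta>\<^sup>2 / 2 * ?sq i"
      using w[of i] by (simp add: block_diff norm_minus_commute field_simps power2_eq_square)
    finally show ?thesis .
  qed
  then have "(\<Sum>i\<in>UNIV. w i * Qmin y i) \<le> (\<Sum>i\<in>UNIV. \<theta> * ?lin i + \<theta>\<^sup>2 / 2 * ?sq i)"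
    by (rule sum_mono)
  also have "\<dots> = \<theta> * (\<Sum>i\<in>UNIV. ?lin i) + \<theta>\<^sup>2 / 2 * (\<Sum>i\<in>UNIV. ?sq i)"
    by (subst sum.distrib) (simp only: sum_distrib_left)
  also have "\<theta> * (\<Sum>i\<in>UNIV. ?lin i) \<le> \<theta> * (- gap y)"
  proof (rule mult_left_mono[OF _ theta(1)])
    have "(\<Sum>i\<in>UNIV. ?lin i)
        = grad y \<bullet> (z - y) + (\<Sum>i\<in>UNIV. psi_at i z) - (\<Sum>i\<in>UNIV. psi_at i y)"
      by (simp add: sum.distrib sum_subtractf inner_sum_blocks)
    also have "\<dots> \<le> gap z - gap y"
      using convex_gradient_inequality[OF f_convex f_grad, of y z] y minimizer_finite[OF z]
      by (simp add: gap_eq)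
    finally show "(\<Sum>i\<in>UNIV. ?lin i) \<le> - gap y"
      by (simp add: gap_minimizer[OF z])
  qed
  finally show ?thesis
    by simp
qed

text \<open>
  The zero step has model value \<open>0\<close>, so the inexactness criterion says that the computed step achieves
  at least the fraction \<open>1 - \<eta>\<close> of the best possible model decrease.
\<close>

lemma inexact_step_gap:
  assumes y: "F y < \<infinity>" and h: "h \<in> block_space blk i"
    and inexact: "Q y i h - subproblem_inf blk grad L \<psi> y i
      \<le> ereal \<eta> * (Q y i 0 - subproblem_inf blk grad L \<psi> y i)"
  shows "F (y + h) < \<infinity>" and "gap (y + h) \<le> gap y + (1 - \<eta>) * Qmin y i"
proof -
  have Q: "Q y i h \<le> ereal ((1 - \<eta>) * Qmin y i)"
    using inexact y
    by (cases "Q y i h") (auto simp: subproblem_zero subproblem_inf_eq_real algebra_simps)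
  have "F (y + h) \<le> F y + Q y i h"
    by (rule F_block_step[OF y h])
  also have "\<dots> \<le> F y + ereal ((1 - \<eta>) * Qmin y i)"
    by (rule add_left_mono[OF Q])
  finally have le: "F (y + h) \<le> ereal (Fmin + gap y + (1 - \<eta>) * Qmin y i)"
    using y by (simp add: F_eq_gap)
  then show "F (y + h) < \<infinity>"
    by (auto intro: le_less_trans)
  with le show "gap (y + h) \<le> gap y + (1 - \<eta>) * Qmin y i"
    by (simp add: F_eq_gap)
qed

end

section \<open>Expected decrease proportional to the square\<close>

text \<open>
  The recursion makes \<open>1 / e n\<close> grow by at least \<open>c\<close> in every step.  The proof uses the consequence
  \<open>e (Suc n) \<le> e n / (1 + c * e n)\<close>, which also covers \<open>e n = 0\<close>, and the monotonicity of
  \<open>t / (1 + c * t)\<close>.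
\<close>

lemma quadratic_decrease_rate:
  fixes e :: "nat \<Rightarrow> real"
  assumes nonneg: "\<And>n. 0 \<le> e n" and start: "e 0 \<le> B" and "0 < B" "0 \<le> c"
    and decrease: "\<And>n. e (Suc n) \<le> e n - c * (e n)\<^sup>2"
  shows "e n \<le> B / (1 + c * B * real n)"
proof (induction n)
  case (Suc n)
  define b where "b = B / (1 + c * B * real n)"
  have pos: "0 < 1 + c * B * real n"
    using assms by (simp add: add_pos_nonneg)
  have b: "0 < b"
    using pos \<open>0 < B\<close> by (simp add: b_def)
  have a: "0 \<le> c * e n"
    using assms by simp
  \<comment> \<open>cross-multiplied with \<open>(1 - c * e n) * (1 + c * e n) \<le> 1\<close>, which avoids dividing by \<open>e n\<close>\<close>
  have "e (Suc n) * (1 + c * e n) \<le> (e n - c * (e n)\<^sup>2) * (1 + c * e n)"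
    using decrease[of n] a by (intro mult_right_mono) auto
  also have "\<dots> = e n - e n * (c * e n)\<^sup>2"
    by (simp add: power2_eq_square algebra_simps)
  also have "\<dots> \<le> e n"
    using nonneg[of n] by simp
  finally have "e (Suc n) \<le> e n / (1 + c * e n)"
    using a by (simp add: pos_le_divide_eq)
  also have "\<dots> \<le> b / (1 + c * b)"
  proof -
    have "0 < 1 + c * b"
      using b \<open>0 \<le> c\<close> by (intro add_pos_nonneg mult_nonneg_nonneg) auto
    moreover have "e n * (1 + c * b) \<le> b * (1 + c * e n)"
      using Suc[folded b_def] by (simp add: algebra_simps)
    ultimately show ?thesis
      using a by (simp add: pos_divide_le_eq pos_le_divide_eq)
  qed
  also have "\<dots> = B / (1 + c * B * real (Suc n))"
  proof -
    define s where "s = 1 + c * B * real n"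
    have s: "b = B / s" "0 < s" "1 + c * B * real (Suc n) = s + c * B"
      using pos by (simp_all add: b_def s_def algebra_simps)
    have "0 < 1 + c * b" "0 < s + c * B"
      using b \<open>0 < s\<close> \<open>0 < B\<close> \<open>0 \<le> c\<close> by (simp_all add: add_pos_nonneg)
    moreover have "b * (s + c * B) = B * (1 + c * b)"
      using s(1,2) by (simp add: algebra_simps)
    ultimately show ?thesis
      unfolding s(3) by (simp add: frac_eq_eq)
  qed
  finally show ?case .
qed (use start in simp)

lemma finite_set_Pi_pmf:
  fixes p :: "'k \<Rightarrow> 'a::finite pmf"
  shows "finite A \<Longrightarrow> finite (set_pmf (Pi_pmf A dflt p))"
  by (simp add: set_Pi_pmf finite_PiE_dflt)

lemma expectation_Pi_pmf_insert:
  fixes h :: "('k \<Rightarrow> 'a::finite) \<Rightarrow> real"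
  assumes "finite A" "k \<notin> A"
  shows "measure_pmf.expectation (Pi_pmf (insert k A) dflt p) h
    = measure_pmf.expectation (Pi_pmf A dflt p)
        (\<lambda>\<iota>. measure_pmf.expectation (p k) (\<lambda>i. h (\<iota>(k := i))))"
proof -
  have fin: "finite (set_pmf (Pi_pmf A dflt p))"
    using assms by (auto simp: set_Pi_pmf intro!: finite_PiE_dflt)
  have "Pi_pmf (insert k A) dflt p
      = Pi_pmf A dflt p \<bind> (\<lambda>\<iota>. map_pmf (\<lambda>i. \<iota>(k := i)) (p k))"
    unfolding Pi_pmf_insert'[OF assms] map_pmf_def by (rule bind_commute_pmf)
  then show ?thesis
    using fin by (simp add: pmf_expectation_bind[OF fin] integral_measure_pmf_real[OF fin] mult.commute)
qed

lemma block_expectation_real: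
  fixes p :: "nat \<Rightarrow> 'b::finite pmf"
  assumes "\<And>\<omega>. X \<omega> = ereal (g \<omega>)"
  shows "block_expectation p a b X \<omega>
    = ereal (measure_pmf.expectation (Pi_pmf {a..<b} undefined p)
        (\<lambda>\<iota>. g (override_on \<omega> \<iota> {a..<b})))"
  by (simp add: block_expectation_def assms ereal_expectation_real finite_set_Pi_pmf)

text \<open>
  The tower property for the independent choices: the expectation over the last choice is taken
  inside, with all earlier choices fixed.
\<close>

lemma expectation_choices_Suc:
  fixes g :: "(nat \<Rightarrow> 'b::finite) \<Rightarrow> real"
  assumes "a \<le> k"
  shows "measure_pmf.expectation (Pi_pmf {a..<Suc k} undefined p)
      (\<lambda>\<iota>. g (override_on \<omega> \<iota> {a..<Suc k}))
    = measure_pmf.expectation (Pi_pmf {a..<k} undefined p)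
      (\<lambda>\<iota>. measure_pmf.expectation (p k)
        (\<lambda>i. g ((override_on \<omega> \<iota> {a..<k})(k := i))))"
proof -
  have "override_on \<omega> (\<iota>(k := i)) {a..<Suc k} = (override_on \<omega> \<iota> {a..<k})(k := i)" for \<iota> i
    using assms by (auto simp: override_on_def fun_eq_iff)
  then show ?thesis
    using assms expectation_Pi_pmf_insert[of "{a..<k}" k undefined p]
    by (simp add: atLeastLessThanSuc)
qed

text \<open>
  A conditional decrease by \<open>c\<close> times the square is inherited by the expectations, because the
  second moment is at least the square of the mean.  The decrease is required only for choice
  sequences that agree with \<open>\<omega>\<close> before iteration \<open>a\<close>, since \<open>\<omega>\<close> is fixed there.
\<close>

lemma expectation_quadratic_decrease:
  fixes p :: "nat \<Rightarrow> 'b::finite pmf" and g :: "nat \<Rightarrow> (nat \<Rightarrow> 'b) \<Rightarrow> real"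
  assumes nonneg: "\<And>k \<omega>. 0 \<le> g k \<omega>"
    and start: "g a \<omega> \<le> B" and "0 < B" "0 \<le> c"
    and decrease: "\<And>k \<omega>'. a \<le> k \<Longrightarrow> (\<And>j. j < a \<Longrightarrow> \<omega>' j = \<omega> j) \<Longrightarrow>
      measure_pmf.expectation (p k) (\<lambda>i. g (Suc k) (\<omega>'(k := i)))
        \<le> g k \<omega>' - c * (g k \<omega>')\<^sup>2"
    and "a \<le> k"
  shows "measure_pmf.expectation (Pi_pmf {a..<k} undefined p)
      (\<lambda>\<iota>. g k (override_on \<omega> \<iota> {a..<k})) \<le> B / (1 + c * B * real (k - a))"
proof -
  define e where "e n = measure_pmf.expectation (Pi_pmf {a..<a + n} undefined p)
    (\<lambda>\<iota>. g (a + n) (override_on \<omega> \<iota> {a..<a + n}))" for n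
  have "e n \<le> B / (1 + c * B * real n)" for n
  proof (rule quadratic_decrease_rate)
    show "0 \<le> e n" for n
      by (simp add: e_def nonneg)
    show "e 0 \<le> B"
      using start by (simp add: e_def)
    show "e (Suc n) \<le> e n - c * (e n)\<^sup>2" for n
    proof -
      let ?P = "Pi_pmf {a..<a + n} undefined p"
      let ?X = "\<lambda>\<iota>. g (a + n) (override_on \<omega> \<iota> {a..<a + n})"
      have int: "integrable ?P h" for h :: "_ \<Rightarrow> real"
        by (simp add: integrable_measure_pmf_finite finite_set_Pi_pmf)
      have "e (Suc n) = measure_pmf.expectation ?P (\<lambda>\<iota>. measure_pmf.expectation (p (a + n))
          (\<lambda>i. g (Suc (a + n)) ((override_on \<omega> \<iota> {a..<a + n})(a + n := i))))"
        unfolding e_def add_Suc_right by (rule expectation_choices_Suc) simp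
      also have "\<dots> \<le> measure_pmf.expectation ?P (\<lambda>\<iota>. ?X \<iota> - c * (?X \<iota>)\<^sup>2)"
        by (intro integral_mono int decrease) (auto simp: override_on_def)
      also have "\<dots> = e n - c * measure_pmf.expectation ?P (\<lambda>\<iota>. (?X \<iota>)\<^sup>2)"
        by (simp add: int e_def)
      also have "\<dots> \<le> e n - c * (e n)\<^sup>2"
        using measure_pmf.variance_eq[of ?P ?X, OF int int] measure_pmf.variance_positive[of ?P ?X]
          \<open>0 \<le> c\<close>
        by (intro diff_left_mono mult_left_mono) (simp_all add: e_def)
      finally show ?thesis .
    qed
  qed (use assms in auto)
  from this[of "k - a"] show ?thesis
    using \<open>a \<le> k\<close> by (simp add: e_def)
qed

section \<open>Convergence of inexact randomized block-coordinate descent\<close>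

locale inexact_rcd_run = composite_minimization blk f grad \<psi> L
  for blk :: "'n::finite \<Rightarrow> 'b::finite" and f grad \<psi> L +
  fixes \<eta> :: real and x0 :: "real ^ 'n"
    and x :: "nat \<Rightarrow> (nat \<Rightarrow> 'b) \<Rightarrow> real ^ 'n"
    and d :: "nat \<Rightarrow> (nat \<Rightarrow> 'b) \<Rightarrow> 'b \<Rightarrow> real ^ 'n"
  assumes eta: "\<eta> < 1"
    and x0_finite: "composite blk f \<psi> x0 < \<infinity>"
    and algorithm: "inexact_rcd \<eta> blk grad L \<psi> x0 x d"
begin

lemma x_0: "x 0 \<omega> = x0"
  and x_Suc: "x (Suc k) \<omega> = x k \<omega> + d k \<omega> (\<omega> k)"
  and d_cong: "(\<And>j. j < k \<Longrightarrow> \<omega> j = \<omega>' j) \<Longrightarrow> d k \<omega> = d k \<omega>'"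
  and d_in_block_space: "d k \<omega> i \<in> block_space blk i"
  and d_inexact: "Q (x k \<omega>) i (d k \<omega> i) - subproblem_inf blk grad L \<psi> (x k \<omega>) i
      \<le> ereal \<eta> * (Q (x k \<omega>) i 0 - subproblem_inf blk grad L \<psi> (x k \<omega>) i)"
  using algorithm unfolding inexact_rcd_def by blast+

lemma x_cong: "(\<And>j. j < k \<Longrightarrow> \<omega> j = \<omega>' j) \<Longrightarrow> x k \<omega> = x k \<omega>'"
proof (induction k)
  case (Suc k)
  have "x k \<omega> = x k \<omega>'" "d k \<omega> = d k \<omega>'"
    using Suc by (auto intro!: d_cong)
  then show ?case
    using Suc.prems[of k] by (simp add: x_Suc)
qed (simp add: x_0)

lemma F_x_finite: "F (x k \<omega>) < \<infinity>"
proof (induction k)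
  case (Suc k)
  then show ?case
    unfolding x_Suc by (rule inexact_step_gap(1)[OF _ d_in_block_space d_inexact])
qed (use x0_finite in \<open>simp add: x_0\<close>)

lemma gap_step: "gap (x k \<omega> + d k \<omega> i) \<le> gap (x k \<omega>) + (1 - \<eta>) * Qmin (x k \<omega>) i"
  by (rule inexact_step_gap(2)[OF F_x_finite d_in_block_space d_inexact])

lemma F_x_eq: "F (x k \<omega>) = ereal (Fmin + gap (x k \<omega>))"
  by (rule F_eq_gap[OF F_x_finite])

text \<open>
  The objective is nonincreasing along every sequence of choices, not only in expectation.  This
  keeps the iterates in the initial level set, where the distance to the minimizers is bounded, and
  preserves any upper bound on the gap once it has been reached.
\<close>

lemma gap_Suc_le: "gap (x (Suc k) \<omega>) \<le> gap (x k \<omega>)"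
proof -
  have "(1 - \<eta>) * Qmin (x k \<omega>) (\<omega> k) \<le> 0"
    using eta Qmin_nonpos[OF F_x_finite] by (intro mult_nonneg_nonpos) auto
  then show ?thesis
    using gap_step[of k \<omega> "\<omega> k"] by (simp add: x_Suc)
qed

lemma gap_antimono: "j \<le> k \<Longrightarrow> gap (x k \<omega>) \<le> gap (x j \<omega>)"
  by (rule lift_Suc_antimono_le[of "\<lambda>k. gap (x k \<omega>)"]) (rule gap_Suc_le)

lemma F_x_le: "F (x k \<omega>) \<le> F x0"
  using gap_antimono[of 0 k \<omega>] F_x_eq[of k \<omega>] F_x_eq[of 0 \<omega>] by (simp add: x_0)

text \<open>
  Sampling block \<open>i\<close> with probability \<open>w i / W\<close> turns the expected model decrease into the weighted sum
  bounded in \<open>weighted_sum_Qmin_le\<close>.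
\<close>

lemma expected_gap_le:
  assumes w: "\<And>i. 0 < w i" and W: "W = (\<Sum>i\<in>UNIV. w i)"
    and p: "\<And>i. pmf p i = w i / W"
    and theta: "0 \<le> \<theta>" "\<And>i. \<theta> \<le> w i"
    and z: "z \<in> minimizers"
  shows "measure_pmf.expectation p (\<lambda>i. gap (x (Suc k) (\<omega> (k := i))))
    \<le> gap (x k \<omega>) - (1 - \<eta>) / W * (\<theta> * gap (x k \<omega>)
        - \<theta>\<^sup>2 / 2 * (\<Sum>i\<in>UNIV. L i / w i * (norm (block blk i (x k \<omega> - z)))\<^sup>2))"
proof -
  have "0 < W"
    unfolding W by (intro sum_pos w) auto
  have step: "x (Suc k) (\<omega> (k := i)) = x k \<omega> + d k \<omega> i" for i
  proof -
    have "x k (\<omega> (k := i)) = x k \<omega>" "d k (\<omega> (k := i)) = d k \<omega>"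
      by (auto intro!: x_cong d_cong)
    then show ?thesis
      by (simp add: x_Suc)
  qed
  have "measure_pmf.expectation p (\<lambda>i. gap (x (Suc k) (\<omega> (k := i))))
      = (\<Sum>i\<in>UNIV. w i / W * gap (x k \<omega> + d k \<omega> i))"
    by (simp add: integral_measure_pmf_real[of UNIV] p step mult.commute)
  also have "\<dots> \<le> (\<Sum>i\<in>UNIV. w i / W * (gap (x k \<omega>) + (1 - \<eta>) * Qmin (x k \<omega>) i))"
    using w \<open>0 < W\<close> by (intro sum_mono mult_left_mono gap_step) (auto simp: less_imp_le)
  also have "\<dots> = gap (x k \<omega>) + (1 - \<eta>) / W * (\<Sum>i\<in>UNIV. w i * Qmin (x k \<omega>) i)"
  proof -
    have "(\<Sum>i\<in>UNIV. w i / W) = 1"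
      using \<open>0 < W\<close> by (simp add: W flip: sum_divide_distrib)
    then have "(\<Sum>i\<in>UNIV. w i / W * gap (x k \<omega>)) = gap (x k \<omega>)"
      by (metis mult_1 sum_distrib_right)
    moreover have "(\<Sum>i\<in>UNIV. w i / W * ((1 - \<eta>) * Qmin (x k \<omega>) i))
        = (1 - \<eta>) / W * (\<Sum>i\<in>UNIV. w i * Qmin (x k \<omega>) i)"
      by (simp add: sum_distrib_left mult_ac)
    ultimately show ?thesis
      by (simp only: distrib_left sum.distrib)
  qed
  also have "\<dots> \<le> gap (x k \<omega>) + (1 - \<eta>) / W * (- \<theta> * gap (x k \<omega>)
      + \<theta>\<^sup>2 / 2 * (\<Sum>i\<in>UNIV. L i / w i * (norm (block blk i (x k \<omega> - z)))\<^sup>2))"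
    using eta \<open>0 < W\<close> w theta z
    by (intro add_left_mono mult_left_mono weighted_sum_Qmin_le F_x_finite) auto
  finally show ?thesis
    by (simp add: algebra_simps)
qed

text \<open>
  When the gap dominates \<open>\<mu>\<close> times the quadratic coefficient, the largest value of \<open>\<theta>\<close> that
  the lower bound \<open>\<mu>\<close> of the weights certifies as admissible, \<open>\<mu>\<close> itself, is taken.  The quadratic term then consumes at most half of the linear decrease.
\<close>

theorem expected_linear_decrease:
  assumes w: "\<And>i. 0 < w i" and W: "W = (\<Sum>i\<in>UNIV. w i)"
    and p: "\<And>i. pmf (p k) i = w i / W"
    and \<mu>: "0 < \<mu>" "\<And>i. \<mu> \<le> w i"
    and z: "z \<in> minimizers"
    and far: "\<mu> * (\<Sum>i\<in>UNIV. L i / w i * (norm (block blk i (x k \<omega> - z)))\<^sup>2) \<le> gap (x k \<omega>)"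
  shows "block_expectation p k (Suc k) (\<lambda>\<omega>'. F (x (Suc k) \<omega>') - ereal Fmin) \<omega>
    \<le> ereal (1 - \<mu> * (1 - \<eta>) / (2 * W)) * (F (x k \<omega>) - ereal Fmin)"
proof -
  let ?D = "\<Sum>i\<in>UNIV. L i / w i * (norm (block blk i (x k \<omega> - z)))\<^sup>2"
  have "0 < W"
    unfolding W by (intro sum_pos w) auto
  have gap: "F (x k \<omega>) - ereal Fmin = ereal (gap (x k \<omega>))" for k \<omega>
    by (simp add: F_x_eq)
  have "measure_pmf.expectation (p k) (\<lambda>i. gap (x (Suc k) (\<omega> (k := i))))
      \<le> gap (x k \<omega>) - (1 - \<eta>) / W * (\<mu> * gap (x k \<omega>) - \<mu>\<^sup>2 / 2 * ?D)"
    using w W p \<mu> z by (intro expected_gap_le) auto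
  also have "\<dots> \<le> gap (x k \<omega>) - (1 - \<eta>) / W * (\<mu> / 2 * gap (x k \<omega>))"
  proof -
    have "\<mu> / 2 * (\<mu> * ?D) \<le> \<mu> / 2 * gap (x k \<omega>)"
      using \<mu> by (intro mult_left_mono far) auto
    then show ?thesis
      using eta \<open>0 < W\<close>
      by (intro diff_left_mono mult_left_mono) (auto simp: power2_eq_square field_simps)
  qed
  also have "\<dots> = (1 - \<mu> * (1 - \<eta>) / (2 * W)) * gap (x k \<omega>)"
    by (simp add: algebra_simps)
  finally have "measure_pmf.expectation (p k) (\<lambda>i. gap (x (Suc k) (\<omega> (k := i))))
      \<le> (1 - \<mu> * (1 - \<eta>) / (2 * W)) * gap (x k \<omega>)" .
  moreover have "block_expectation p k (Suc k) (\<lambda>\<omega>'. F (x (Suc k) \<omega>') - ereal Fmin) \<omega>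
      = ereal (measure_pmf.expectation (p k) (\<lambda>i. gap (x (Suc k) (\<omega> (k := i)))))"
    using expectation_choices_Suc[where a = k and k = k and p = p and \<omega> = \<omega>
        and g = "\<lambda>\<omega>'. gap (x (Suc k) \<omega>')"]
    by (simp add: block_expectation_real[OF gap])
  ultimately show ?thesis
    by (simp add: gap)
qed

text \<open>
  Near the minimum the best \<open>\<theta>\<close>, which is the gap divided by a bound \<open>M * R\<^sup>2\<close> of the quadratic
  coefficient, is admissible; it yields an expected decrease proportional to the squared gap.
  The value from which the recursion starts, \<open>W * M * R\<^sup>2 / CARD('b)\<close>, dominates the threshold
  \<open>\<mu> * M * R\<^sup>2\<close> because \<open>W\<close> is a sum of \<open>CARD('b)\<close> weights, each at least \<open>\<mu>\<close>.
\<close>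

theorem expected_sublinear_rate:
  assumes w: "\<And>i. 0 < w i" and W: "W = (\<Sum>i\<in>UNIV. w i)"
    and p: "\<And>k i. pmf (p k) i = w i / W"
    and \<mu>: "0 < \<mu>" "\<And>i. \<mu> \<le> w i"
    and M: "0 < M" "\<And>i. L i / w i \<le> M"
    and radius: "\<And>y. F y \<le> F x0 \<Longrightarrow> norm (y - closest_point minimizers y) \<le> R"
    and near: "F (x k0 \<omega>) - ereal Fmin < ereal (\<mu> * M * R\<^sup>2)"
    and "k0 \<le> k"
  shows "block_expectation p k0 k (\<lambda>\<omega>'. F (x k \<omega>')) \<omega> - ereal Fmin
    \<le> ereal (2 * W * M * R\<^sup>2 / (2 * real CARD('b) + (1 - \<eta>) * real (k - k0)))"
proof -
  define N where "N = real CARD('b)"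
  have "0 < W"
    unfolding W by (intro sum_pos w) auto
  have "0 < N"
    by (simp add: N_def)
  have near': "gap (x k0 \<omega>) < \<mu> * M * R\<^sup>2"
    using near by (simp add: F_x_eq)
  then have "0 < \<mu> * M * R\<^sup>2"
    using gap_nonneg[OF F_x_finite, of k0 \<omega>] by simp
  then have "0 < R\<^sup>2"
    using \<mu> M by (simp add: zero_less_mult_iff)
  have "N * \<mu> \<le> W"
    using sum_mono[of UNIV "\<lambda>_. \<mu>" w] \<mu> by (simp add: W N_def)
  \<comment> \<open>\<open>c * B = (1 - \<eta>) / (2 * N)\<close>, so the common factors cancel in the denominator of the rate\<close>
  define B where "B = W * M * R\<^sup>2 / N"
  define c where "c = (1 - \<eta>) / (2 * W * M * R\<^sup>2)"
  have decrease: "measure_pmf.expectation (p k) (\<lambda>i. gap (x (Suc k) (\<omega>'(k := i))))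
      \<le> gap (x k \<omega>') - c * (gap (x k \<omega>'))\<^sup>2"
    if "k0 \<le> k" and agree: "\<And>j. j < k0 \<Longrightarrow> \<omega>' j = \<omega> j" for k \<omega>'
  proof -
    let ?z = "closest_point minimizers (x k \<omega>')"
    let ?D = "\<Sum>i\<in>UNIV. L i / w i * (norm (block blk i (x k \<omega>' - ?z)))\<^sup>2"
    \<comment> \<open>minimizes \<open>- \<theta> * gap + \<theta>\<^sup>2 / 2 * (M * R\<^sup>2)\<close>\<close>
    define \<theta> where "\<theta> = gap (x k \<omega>') / (M * R\<^sup>2)"
    have "gap (x k \<omega>') \<le> gap (x k0 \<omega>')"
      using \<open>k0 \<le> k\<close> by (rule gap_antimono)
    also have "x k0 \<omega>' = x k0 \<omega>"
      by (rule x_cong) (rule agree)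
    finally have "\<theta> \<le> \<mu>"
      using near' M \<open>0 < R\<^sup>2\<close> by (simp add: \<theta>_def field_simps)
    have "0 \<le> \<theta>"
      using gap_nonneg[OF F_x_finite] M by (simp add: \<theta>_def)
    have "?D \<le> (\<Sum>i\<in>UNIV. M * (norm (block blk i (x k \<omega>' - ?z)))\<^sup>2)"
      by (intro sum_mono mult_right_mono M) auto
    also have "\<dots> = M * (norm (x k \<omega>' - ?z))\<^sup>2"
      by (simp add: norm_sum_blocks flip: sum_distrib_left)
    also have "\<dots> \<le> M * R\<^sup>2"
      using M by (intro mult_left_mono power_mono radius F_x_le) auto
    finally have D: "?D \<le> M * R\<^sup>2" .
    have "measure_pmf.expectation (p k) (\<lambda>i. gap (x (Suc k) (\<omega>'(k := i))))
        \<le> gap (x k \<omega>') - (1 - \<eta>) / W * (\<theta> * gap (x k \<omega>') - \<theta>\<^sup>2 / 2 * ?D)"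
      using w W p \<open>0 \<le> \<theta>\<close> \<open>\<theta> \<le> \<mu>\<close> \<mu> closest_minimizer
      by (intro expected_gap_le) (auto intro: order_trans)
    also have "\<dots> \<le> gap (x k \<omega>')
        - (1 - \<eta>) / W * (\<theta> * gap (x k \<omega>') - \<theta>\<^sup>2 / 2 * (M * R\<^sup>2))"
      using D eta \<open>0 < W\<close> by (intro diff_left_mono mult_left_mono) auto
    also have "\<dots> = gap (x k \<omega>') - c * (gap (x k \<omega>'))\<^sup>2"
      using M \<open>0 < R\<^sup>2\<close> \<open>0 < W\<close> by (simp add: \<theta>_def c_def field_simps power2_eq_square)
    finally show ?thesis .
  qed
  have "measure_pmf.expectation (Pi_pmf {k0..<k} undefined p)
      (\<lambda>\<iota>. gap (x k (override_on \<omega> \<iota> {k0..<k}))) \<le> B / (1 + c * B * real (k - k0))"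
  proof (rule expectation_quadratic_decrease)
    have "\<mu> * M * R\<^sup>2 \<le> W / N * M * R\<^sup>2"
      using \<open>N * \<mu> \<le> W\<close> \<open>0 < N\<close> M by (intro mult_right_mono) (auto simp: field_simps)
    then show "gap (x k0 \<omega>) \<le> B"
      using near' by (simp add: B_def)
    show "0 < B"
      using \<open>0 < W\<close> \<open>0 < N\<close> \<open>0 < R\<^sup>2\<close> M by (simp add: B_def)
    show "0 \<le> c"
      using \<open>0 < W\<close> M eta by (simp add: c_def)
  qed (rule gap_nonneg[OF F_x_finite] decrease \<open>k0 \<le> k\<close> | assumption)+
  also have "\<dots> = 2 * W * M * R\<^sup>2 / (2 * N + (1 - \<eta>) * real (k - k0))"
  proof -
    have "c * B = (1 - \<eta>) / (2 * N)"
      using \<open>0 < W\<close> \<open>0 < N\<close> \<open>0 < R\<^sup>2\<close> M by (simp add: B_def c_def field_simps)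
    then have "1 + c * B * real (k - k0) = (2 * N + (1 - \<eta>) * real (k - k0)) / (2 * N)"
      using \<open>0 < N\<close> by (simp add: add_divide_distrib)
    then show ?thesis
      using \<open>0 < N\<close> by (simp add: B_def)
  qed
  finally have rate: "measure_pmf.expectation (Pi_pmf {k0..<k} undefined p)
      (\<lambda>\<iota>. gap (x k (override_on \<omega> \<iota> {k0..<k})))
    \<le> 2 * W * M * R\<^sup>2 / (2 * N + (1 - \<eta>) * real (k - k0))" .
  have "block_expectation p k0 k (\<lambda>\<omega>'. F (x k \<omega>')) \<omega>
      = ereal (measure_pmf.expectation (Pi_pmf {k0..<k} undefined p)
        (\<lambda>\<iota>. Fmin + gap (x k (override_on \<omega> \<iota> {k0..<k}))))"
    by (rule block_expectation_real) (rule F_x_eq)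
  also have "\<dots> = ereal (Fmin + measure_pmf.expectation (Pi_pmf {k0..<k} undefined p)
        (\<lambda>\<iota>. gap (x k (override_on \<omega> \<iota> {k0..<k}))))"
    by (simp add: integrable_measure_pmf_finite finite_set_Pi_pmf)
  finally show ?thesis
    using rate by (simp add: N_def)
qed

end

section \<open>Uniform sampling and sampling proportional to the Lipschitz constants\<close>

theorem corollary2:
  fixes blk :: "'n::finite \<Rightarrow> 'b::finite"
    and f :: "real ^ 'n \<Rightarrow> real" and grad :: "real ^ 'n \<Rightarrow> real ^ 'n"
    and \<psi> :: "'b \<Rightarrow> real ^ 'n \<Rightarrow> ereal"
    and L :: "'b \<Rightarrow> real" and Lmax Lmin Lavg N \<eta> R0 :: real
    and F :: "real ^ 'n \<Rightarrow> ereal" and Fstar :: ereal and \<Omega> :: "(real ^ 'n) set"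
    and x0 :: "real ^ 'n"
    and x :: "nat \<Rightarrow> (nat \<Rightarrow> 'b) \<Rightarrow> real ^ 'n"
    and d :: "nat \<Rightarrow> (nat \<Rightarrow> 'b) \<Rightarrow> 'b \<Rightarrow> real ^ 'n"
    and p :: "nat \<Rightarrow> 'b pmf"
  assumes f_grad: "\<And>y. GDERIV f y :> grad y"
    and grad_cont: "continuous_on UNIV grad"
    and f_convex: "convex_on UNIV f"
    and L_pos: "\<And>i. L i > 0"
    and f_lipschitz: "\<And>i y h. h \<in> block_space blk i \<Longrightarrow>
      norm (block blk i (grad (y + h)) - block blk i (grad y)) \<le> L i * norm h"
    and psi_convex: "\<And>i. ext_convex_on (block_space blk i) (\<psi> i)"
    and psi_proper: "\<And>i. ext_proper_on (block_space blk i) (\<psi> i)"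
    and psi_closed: "\<And>i. ext_closed_on (block_space blk i) (\<psi> i)"
    and F_eq: "F = composite blk f \<psi>"
    and F_bounded_below: "\<exists>c::real. \<forall>y. ereal c \<le> F y"
    and Omega_eq: "\<Omega> = {y. \<forall>z. F y \<le> F z}"
    and Omega_nonempty: "\<Omega> \<noteq> {}"
    and Fstar_eq: "Fstar = (INF y. F y)"
    and eta: "0 \<le> \<eta>" "\<eta> < 1"
    and x0_dom: "F x0 < \<infinity>"
    and R0_finite: "bdd_above ((\<lambda>y. norm (y - closest_point \<Omega> y)) ` {y. F y \<le> F x0})"
    and R0_eq: "R0 = (SUP y\<in>{y. F y \<le> F x0}. norm (y - closest_point \<Omega> y))"
    and N_eq: "N = real CARD('b)"
    and Lmax_eq: "Lmax = (MAX i. L i)"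
    and Lmin_eq: "Lmin = (MIN i. L i)"
    and Lavg_eq: "Lavg = (\<Sum>i\<in>UNIV. L i) / N"
    and algorithm: "inexact_rcd \<eta> blk grad L \<psi> x0 x d"
  shows
    "((\<forall>k i. pmf (p k) i = 1 / N) \<longrightarrow>
        (\<forall>k \<omega>. F (x k \<omega>) - Fstar \<ge>
            ereal ((x k \<omega> - closest_point \<Omega> (x k \<omega>)) \<bullet>
              (block_diag blk L *v (x k \<omega> - closest_point \<Omega> (x k \<omega>)))) \<longrightarrow>
          block_expectation p k (Suc k) (\<lambda>\<omega>'. F (x (Suc k) \<omega>') - Fstar) \<omega>
            \<le> ereal (1 - (1 - \<eta>) / (2 * N)) * (F (x k \<omega>) - Fstar)) \<and>
        (\<forall>\<omega> k0 k. F (x k0 \<omega>) - Fstar < ereal (Lmax * R0\<^sup>2) \<and>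
            (\<forall>j<k0. \<not> F (x j \<omega>) - Fstar < ereal (Lmax * R0\<^sup>2)) \<and> k0 \<le> k \<longrightarrow>
          block_expectation p k0 k (\<lambda>\<omega>'. F (x k \<omega>')) \<omega> - Fstar
            \<le> ereal (2 * N * Lmax * R0\<^sup>2 / (2 * N + (1 - \<eta>) * real (k - k0))))) \<and>
     ((\<forall>k i. pmf (p k) i = L i / (N * Lavg)) \<longrightarrow>
        (\<forall>k \<omega>. F (x k \<omega>) - Fstar \<ge>
            ereal (Lmin * (norm (x k \<omega> - closest_point \<Omega> (x k \<omega>)))\<^sup>2) \<longrightarrow>
          block_expectation p k (Suc k) (\<lambda>\<omega>'. F (x (Suc k) \<omega>') - Fstar) \<omega>
            \<le> ereal (1 - Lmin * (1 - \<eta>) / (2 * N * Lavg)) * (F (x k \<omega>) - Fstar)) \<and>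
        (\<forall>\<omega> k0 k. F (x k0 \<omega>) - Fstar < ereal (Lmin * R0\<^sup>2) \<and>
            (\<forall>j<k0. \<not> F (x j \<omega>) - Fstar < ereal (Lmin * R0\<^sup>2)) \<and> k0 \<le> k \<longrightarrow>
          block_expectation p k0 k (\<lambda>\<omega>'. F (x k \<omega>')) \<omega> - Fstar
            \<le> ereal (2 * N * Lavg * R0\<^sup>2 / (2 * N + (1 - \<eta>) * real (k - k0)))))"
proof -
  interpret inexact_rcd_run blk f grad \<psi> L \<eta> x0 x d
    using f_grad f_convex f_lipschitz psi_convex psi_proper psi_closed Omega_nonempty eta
      x0_dom algorithm
    unfolding F_eq Omega_eq by unfold_locales auto
  have Omega: "\<Omega> = minimizers" and Fstar: "Fstar = ereal Fmin"
    unfolding Omega_eq Fstar_eq F_eq minimizers_def by (simp_all add: INF_F_eq)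
  have radius: "norm (y - closest_point minimizers y) \<le> R0"
    if "composite blk f \<psi> y \<le> composite blk f \<psi> x0" for y
    unfolding R0_eq using that R0_finite by (auto simp: Omega F_eq intro: cSUP_upper)
  have gap: "F (x k \<omega>) - Fstar = ereal (gap (x k \<omega>))" for k \<omega>
    by (simp add: F_eq Fstar F_x_eq)
  have Lmax: "L i \<le> Lmax" and Lmin: "Lmin \<le> L i" for i
    by (simp_all add: Lmax_eq Lmin_eq)
  have "0 < Lmax"
    using L_pos Lmax by (meson less_le_trans)
  have "0 < Lmin"
    using L_pos by (simp add: Lmin_eq)
  have "0 < N"
    by (simp add: N_eq)
  have L_sum: "N * Lavg = (\<Sum>i\<in>UNIV. L i)"
    using \<open>0 < N\<close> by (simp add: Lavg_eq)
  show ?thesis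
  proof (intro conjI impI allI)
    \<comment> \<open>weights \<open>1\<close>: the quadratic term is the \<open>block_diag blk L\<close>-weighted squared distance\<close>
    fix k \<omega>
    let ?v = "x k \<omega> - closest_point \<Omega> (x k \<omega>)"
    assume p: "\<forall>k i. pmf (p k) i = 1 / N"
      and far: "ereal (?v \<bullet> (block_diag blk L *v ?v)) \<le> F (x k \<omega>) - Fstar"
    show "block_expectation p k (Suc k) (\<lambda>\<omega>'. F (x (Suc k) \<omega>') - Fstar) \<omega>
        \<le> ereal (1 - (1 - \<eta>) / (2 * N)) * (F (x k \<omega>) - Fstar)"
    proof -
      have "(\<Sum>i\<in>UNIV. L i * (norm (block blk i ?v))\<^sup>2) \<le> gap (x k \<omega>)"
        using far by (simp add: gap inner_block_diag)
      then show ?thesis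
        using expected_linear_decrease[of "\<lambda>_. 1" N p k 1 "closest_point \<Omega> (x k \<omega>)" \<omega>]
          p closest_minimizer
        by (simp add: N_eq Omega Fstar F_eq)
    qed
  next
    fix \<omega> k0 k
    assume p: "\<forall>k i. pmf (p k) i = 1 / N"
      and "F (x k0 \<omega>) - Fstar < ereal (Lmax * R0\<^sup>2) \<and>
        (\<forall>j<k0. \<not> F (x j \<omega>) - Fstar < ereal (Lmax * R0\<^sup>2)) \<and> k0 \<le> k"
    then show "block_expectation p k0 k (\<lambda>\<omega>'. F (x k \<omega>')) \<omega> - Fstar
        \<le> ereal (2 * N * Lmax * R0\<^sup>2 / (2 * N + (1 - \<eta>) * real (k - k0)))"
      using expected_sublinear_rate[of "\<lambda>_. 1" N p 1 Lmax R0 k0 \<omega> k] radius Lmax \<open>0 < Lmax\<close>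
      by (simp add: N_eq Fstar F_eq)
  next
    \<comment> \<open>weights \<open>L\<close>: the ratios \<open>L i / w i\<close> equal \<open>1\<close>, leaving the Euclidean squared distance\<close>
    fix k \<omega>
    assume p: "\<forall>k i. pmf (p k) i = L i / (N * Lavg)"
      and far: "ereal (Lmin * (norm (x k \<omega> - closest_point \<Omega> (x k \<omega>)))\<^sup>2) \<le> F (x k \<omega>) - Fstar"
    show "block_expectation p k (Suc k) (\<lambda>\<omega>'. F (x (Suc k) \<omega>') - Fstar) \<omega>
        \<le> ereal (1 - Lmin * (1 - \<eta>) / (2 * N * Lavg)) * (F (x k \<omega>) - Fstar)"
    proof -
      have "L i / L i = 1" for i
        using L_pos[of i] by simp
      moreover have "Lmin * (norm (x k \<omega> - closest_point \<Omega> (x k \<omega>)))\<^sup>2 \<le> gap (x k \<omega>)"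
        using far by (simp add: gap)
      ultimately show ?thesis
        using expected_linear_decrease[of L "N * Lavg" p k Lmin "closest_point \<Omega> (x k \<omega>)" \<omega>]
          p closest_minimizer L_pos L_sum Lmin \<open>0 < Lmin\<close>
        by (simp add: norm_sum_blocks Omega Fstar F_eq mult.assoc)
    qed
  next
    fix \<omega> k0 k
    assume p: "\<forall>k i. pmf (p k) i = L i / (N * Lavg)"
      and "F (x k0 \<omega>) - Fstar < ereal (Lmin * R0\<^sup>2) \<and>
        (\<forall>j<k0. \<not> F (x j \<omega>) - Fstar < ereal (Lmin * R0\<^sup>2)) \<and> k0 \<le> k"
    then show "block_expectation p k0 k (\<lambda>\<omega>'. F (x k \<omega>')) \<omega> - Fstar
        \<le> ereal (2 * N * Lavg * R0\<^sup>2 / (2 * N + (1 - \<eta>) * real (k - k0)))"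
      using expected_sublinear_rate[of L "N * Lavg" p Lmin 1 R0 k0 \<omega> k] radius L_pos L_sum Lmin
        \<open>0 < Lmin\<close>
      by (simp add: N_eq Fstar F_eq less_imp_neq[symmetric] mult.assoc)
  qed
qed

end
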